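(* Let $S$ be a numerical semigroup. Then the following statements are equivalent: (1) $S$ is far-flung Gorenstein; (2) $\{0,\dots,m(S)-1\}\subset\{(F(S)-f)+(F(S)-g)\mid f,g\in rPF(S)\}$; (3) $m(S)\le n(B)$, where $B=\{F(S)-f\mid f\in rPF(S)\}$.
   Context: $\mathbb{N}$ denotes the non-negative integers. For integers $x\le y$, $[x,y]=\{z\in\mathbb{Z}\mid x\le z\le y\}$. For sets of integers, $A+B=\{a+b\mid a\in A,b\in B\}$ and $I-J=\{z\in\mathbb{Z}\mid z+y\in I\text{ for all }y\in J\}$ (set difference is written $\setminus$). A numerical semigroup is a submonoid $S$ of $(\mathbb{N},+)$ with $\mathbb{N}\setminus S$ finite. Its multiplicity $m(S)$ is the smallest element of $S\setminus\{0\}$; its Frobenius number $F(S)$ is the largest integer in $\mathbb{Z}\setminus S$. Put $rPF(S)=[F(S)-m(S)+1,F(S)]\setminus S$. Let $C(S)=\{z\in\mathbb{Z}\mid z\ge F(S)+1\}$, $K(S)=\{x\in\mathbb{Z}\mid F(S)-x\notin S\}$, and $\mathrm{tr}(K(S))=K(S)+(S-K(S))$. $S$ is far-flung Gorenstein if $\mathrm{tr}(K(S))=C(S)$. For a finite set $A\subset\mathbb{N}$ with $0\in A$, $n(A)$ is the integer such that $0,1,\dots,n(A)-1\in A+A$ and $n(A)\notin A+A$; if $0\notin A$, $n(A)=-1$. *)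

theory Defs
  imports Main "HOL-Library.Set_Algebras"
begin

(* Numerical semigroups are represented as sets of integers contained in \<nat>, so that
   they live in the same type as F(S) (which is -1 for S = \<nat>), K(S) and C(S).
   The sum A + B of sets is the elementwise sum of Set_Algebras. *)

definition numerical_semigroup :: "int set \<Rightarrow> bool" where
  "numerical_semigroup S \<longleftrightarrow>
     S \<subseteq> \<nat> \<and> 0 \<in> S \<and> (\<forall>x\<in>S. \<forall>y\<in>S. x + y \<in> S) \<and> finite (\<nat> - S)"

definition sg_mult :: "int set \<Rightarrow> int" where
  "sg_mult S = (LEAST x. x \<in> S - {0})"

definition frobenius_number :: "int set \<Rightarrow> int" where
  "frobenius_number S = (GREATEST x. x \<notin> S)"

definition rPF :: "int set \<Rightarrow> int set" where
  "rPF S = {frobenius_number S - sg_mult S + 1 .. frobenius_number S} - S"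

(* The quotient of relative ideals, written I - J in the literature; not the set difference. *)
definition ideal_quot :: "int set \<Rightarrow> int set \<Rightarrow> int set" where
  "ideal_quot I J = {z. \<forall>y\<in>J. z + y \<in> I}"

definition conductor_ideal :: "int set \<Rightarrow> int set" where
  "conductor_ideal S = {z. z \<ge> frobenius_number S + 1}"

definition canonical_ideal :: "int set \<Rightarrow> int set" where
  "canonical_ideal S = {x. frobenius_number S - x \<notin> S}"

definition canonical_trace :: "int set \<Rightarrow> int set" where
  "canonical_trace S = canonical_ideal S + ideal_quot S (canonical_ideal S)"

definition far_flung_gorenstein :: "int set \<Rightarrow> bool" where
  "far_flung_gorenstein S \<longleftrightarrow> canonical_trace S = conductor_ideal S"

(* Meaningful for finite A \<subseteq> \<nat>. The condition 0 \<le> n makes n unique: for negative n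
   the interval {0..n - 1} is empty and n is not in A + A. *)
definition sumset_gap :: "int set \<Rightarrow> int" where
  "sumset_gap A =
     (if 0 \<in> A then (THE n. 0 \<le> n \<and> {0..n - 1} \<subseteq> A + A \<and> n \<notin> A + A) else -1)"

end

theory Submission
  imports Defs
begin

text \<open>Write F, m, K for the Frobenius number, the multiplicity and the canonical ideal of S.
  Since z + y \<in> S holds iff F - z - y \<notin> K, an integer z lies in S - K iff F - z \<notin> K + K. Moreover
  tr(K) = C iff S - K = C, so S is far-flung Gorenstein iff K + K = \<nat>. As K + K is stable under
  adding m, it suffices that K + K contains 0, \<dots>, m - 1, and only the elements of
  K below m, which form B, contribute to these sums.\<close>

lemma frobenius_number_eqI:
  assumes "x \<notin> S" and "\<And>y. x < y \<Longrightarrow> y \<in> S"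
  shows "frobenius_number S = x"
  unfolding frobenius_number_def
  by (rule Greatest_equality) (use assms not_less in blast)+

lemma frobenius_number_props:
  assumes "numerical_semigroup S"
  shows "frobenius_number S \<notin> S" and "frobenius_number S < y \<Longrightarrow> y \<in> S"
proof -
  \<comment> \<open>The extra element -1 keeps \<open>A\<close> nonempty when S = \<nat>, where the
    Frobenius number is -1; it lies outside S because S \<subseteq> \<nat>.\<close>
  define A where "A = insert (-1) (\<nat> - S)"
  have "finite A" and "A \<noteq> {}" and "S \<subseteq> \<nat>"
    using assms by (auto simp: A_def numerical_semigroup_def)
  have "Max A \<in> A"
    using \<open>finite A\<close> \<open>A \<noteq> {}\<close> by (rule Max_in)
  then have notin: "Max A \<notin> S"
    using \<open>S \<subseteq> \<nat>\<close> by (auto simp: A_def Nats_altdef1)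
  have inS: "y \<in> S" if "Max A < y" for y
  proof (rule ccontr)
    assume "y \<notin> S"
    have "-1 \<le> Max A"
      using \<open>finite A\<close> by (intro Max_ge) (auto simp: A_def)
    with that \<open>y \<notin> S\<close> have "y \<in> A"
      by (auto simp: A_def Nats_altdef1)
    then show False
      using that \<open>finite A\<close> Max_ge leD by blast
  qed
  have "frobenius_number S = Max A"
    using notin inS by (rule frobenius_number_eqI)
  with notin inS show "frobenius_number S \<notin> S" and "frobenius_number S < y \<Longrightarrow> y \<in> S"
    by simp_all
qed

lemma sg_mult_props:
  assumes "numerical_semigroup S"
  shows "sg_mult S \<in> S" and "0 < sg_mult S"
proof -
  \<comment> \<open>\<open>LEAST\<close> on the integers has no well-ordering behind it, so the
    minimum is taken over the natural numbers and carried back by \<open>int\<close>.\<close>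
  define P where "P n \<longleftrightarrow> int n \<in> S - {0}" for n
  have "S \<subseteq> \<nat>"
    using assms by (simp add: numerical_semigroup_def)
  \<comment> \<open>The witness \<bar>F\<bar> + 1 is positive and exceeds F, hence is a nonzero
    element of S.\<close>
  have "P (nat (\<bar>frobenius_number S\<bar> + 1))"
    using frobenius_number_props(2)[OF assms, of "\<bar>frobenius_number S\<bar> + 1"]
    by (simp add: P_def)
  then have "P (LEAST n. P n)"
    by (rule LeastI)
  moreover have "sg_mult S = int (LEAST n. P n)"
    unfolding sg_mult_def
  proof (rule Least_equality)
    show "int (LEAST n. P n) \<in> S - {0}"
      using \<open>P (LEAST n. P n)\<close> by (simp add: P_def)
  next
    fix y assume "y \<in> S - {0}"
    moreover from this \<open>S \<subseteq> \<nat>\<close> obtain n where "y = int n"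
      by (auto elim: Nats_cases)
    ultimately show "int (LEAST n. P n) \<le> y"
      by (auto simp: P_def intro: Least_le)
  qed
  ultimately show "sg_mult S \<in> S" and "0 < sg_mult S"
    by (auto simp: P_def)
qed

lemma canonical_ideal_nonneg:
  assumes "numerical_semigroup S" and "x \<in> canonical_ideal S"
  shows "0 \<le> x"
  using frobenius_number_props(2)[OF assms(1), of "frobenius_number S - x"] assms(2)
  by (force simp: canonical_ideal_def)

lemma zero_in_canonical_ideal:
  assumes "numerical_semigroup S"
  shows "0 \<in> canonical_ideal S"
  using frobenius_number_props(1)[OF assms] by (simp add: canonical_ideal_def)

text \<open>By contraposition: if F - (x + s) were in S, adding s would put F - x in S.\<close>

lemma canonical_ideal_add:
  assumes "numerical_semigroup S" and "x \<in> canonical_ideal S" and "s \<in> S"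
  shows "x + s \<in> canonical_ideal S"
proof -
  have "(frobenius_number S - (x + s)) + s \<in> S" if "frobenius_number S - (x + s) \<in> S"
    using that assms unfolding numerical_semigroup_def by blast
  then show ?thesis
    using assms(2) by (auto simp: canonical_ideal_def)
qed

lemma ideal_quot_canonical_iff:
  "z \<in> ideal_quot S (canonical_ideal S) \<longleftrightarrow>
     frobenius_number S - z \<notin> canonical_ideal S + canonical_ideal S"
proof -
  have "z + y \<in> S \<longleftrightarrow> frobenius_number S - z - y \<notin> canonical_ideal S" for y
    by (simp add: canonical_ideal_def)
  moreover have "frobenius_number S - z \<in> canonical_ideal S + canonical_ideal S \<longleftrightarrow>
      (\<exists>y\<in>canonical_ideal S. frobenius_number S - z - y \<in> canonical_ideal S)"
    by (force simp: set_plus_def)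
  ultimately show ?thesis
    by (simp add: ideal_quot_def)
qed

text \<open>Always C \<subseteq> S - K \<subseteq> tr(K), since K has no negative elements and
  contains 0. As C absorbs nonnegative summands, S - K \<subseteq> C forces tr(K) \<subseteq> C, so
  only S - K \<subseteq> C remains to be translated.\<close>

lemma far_flung_gorenstein_iff:
  assumes "numerical_semigroup S"
  shows "far_flung_gorenstein S \<longleftrightarrow> {0..} \<subseteq> canonical_ideal S + canonical_ideal S"
proof -
  let ?K = "canonical_ideal S" and ?Q = "ideal_quot S (canonical_ideal S)"
  let ?C = "conductor_ideal S"
  have "?C \<subseteq> ?Q"
    using canonical_ideal_nonneg[OF assms]
    by (fastforce simp: conductor_ideal_def ideal_quot_def intro: frobenius_number_props(2)[OF assms])
  have "?Q \<subseteq> canonical_trace S"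
    using zero_in_canonical_ideal[OF assms] unfolding canonical_trace_def
    by (metis add.left_neutral set_plus_intro subsetI)
  moreover have "canonical_trace S \<subseteq> ?C" if "?Q \<subseteq> ?C"
    using that canonical_ideal_nonneg[OF assms]
    by (fastforce simp: canonical_trace_def conductor_ideal_def elim!: set_plus_elim)
  ultimately have "far_flung_gorenstein S \<longleftrightarrow> ?Q \<subseteq> ?C"
    using \<open>?C \<subseteq> ?Q\<close> unfolding far_flung_gorenstein_def by blast
  also have "\<dots> \<longleftrightarrow> (\<forall>z. frobenius_number S - z \<notin> ?K + ?K \<longrightarrow> frobenius_number S - z < 0)"
    by (auto simp: ideal_quot_canonical_iff conductor_ideal_def)
  \<comment> \<open>The reflection z \<mapsto> F - z is a bijection of the integers, so w = F - z is
    arbitrary.\<close>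
  also have "\<dots> \<longleftrightarrow> (\<forall>w. w \<notin> ?K + ?K \<longrightarrow> w < 0)"
  proof
    assume H: "\<forall>z. frobenius_number S - z \<notin> ?K + ?K \<longrightarrow> frobenius_number S - z < 0"
    show "\<forall>w. w \<notin> ?K + ?K \<longrightarrow> w < 0"
      using H[rule_format, of "frobenius_number S - w" for w] by simp
  qed blast
  also have "\<dots> \<longleftrightarrow> {0..} \<subseteq> ?K + ?K"
    by (auto simp: not_le[symmetric])
  finally show ?thesis .
qed

lemma nonneg_subset_of_add_closed:
  fixes A :: "int set"
  assumes "0 < m" and "{0..m - 1} \<subseteq> A" and add: "\<And>x. x \<in> A \<Longrightarrow> x + m \<in> A"
  shows "{0..} \<subseteq> A"
proof
  fix x :: int assume "x \<in> {0..}"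
  then have "0 \<le> x" by simp
  \<comment> \<open>Climb from the residue of x, which lies in {0..m - 1}, in steps of m; k = x div
    m reaches x.\<close>
  have "x mod m + int k * m \<in> A" for k
  proof (induction k)
    case 0
    show ?case using assms(1,2) by auto
  next
    case (Suc k)
    show ?case using add[OF Suc] by (simp add: algebra_simps)
  qed
  from this[of "nat (x div m)"] show "x \<in> A"
    using \<open>0 \<le> x\<close> \<open>0 < m\<close> by (simp add: pos_imp_zdiv_nonneg_iff)
qed

text \<open>Reflection in F carries the complement of S onto K and the interval [F - m + 1, F] onto
  [0, m - 1].\<close>

lemma rPF_reflect:
  "{frobenius_number S - f | f. f \<in> rPF S} = canonical_ideal S \<inter> {0..sg_mult S - 1}"
proof (intro set_eqI iffI)
  fix x assume "x \<in> canonical_ideal S \<inter> {0..sg_mult S - 1}"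
  then have "frobenius_number S - x \<in> rPF S"
    by (auto simp: rPF_def canonical_ideal_def)
  moreover have "x = frobenius_number S - (frobenius_number S - x)" by simp
  ultimately show "x \<in> {frobenius_number S - f | f. f \<in> rPF S}" by blast
qed (auto simp: rPF_def canonical_ideal_def)

text \<open>This links conditions (2) and (3). Since \<open>A + A\<close> is finite, it misses some
  natural number, and the least one missed is the value that the \<open>THE\<close> in
  \<open>sumset_gap\<close> selects.\<close>

lemma le_sumset_gap_iff:
  assumes "finite A" and "0 \<in> A"
  shows "m \<le> sumset_gap A \<longleftrightarrow> {0..m - 1} \<subseteq> A + A"
proof -
  define P where "P n \<longleftrightarrow> int n \<notin> A + A" for n
  have "finite (A + A)"
    using \<open>finite A\<close> by (simp add: finite_set_plus)
  then have "finite {n. int n \<in> A + A}"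
    using finite_vimageI[of "A + A" int] by (simp add: vimage_def)
  then have "\<exists>n. P n"
    using ex_new_if_finite[OF infinite_UNIV_nat] by (auto simp: P_def)
  define g where "g = int (LEAST n. P n)"
  have g: "0 \<le> g" "g \<notin> A + A"
    using LeastI_ex[OF \<open>\<exists>n. P n\<close>] by (auto simp: g_def P_def)
  have below: "x \<in> A + A" if "0 \<le> x" "x < g" for x
    using not_less_Least[of "nat x" P] that by (auto simp: g_def P_def)
  have "sumset_gap A = (THE n. 0 \<le> n \<and> {0..n - 1} \<subseteq> A + A \<and> n \<notin> A + A)"
    using \<open>0 \<in> A\<close> by (simp add: sumset_gap_def)
  also have "\<dots> = g"
  proof (rule the_equality)
    show "0 \<le> g \<and> {0..g - 1} \<subseteq> A + A \<and> g \<notin> A + A"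
      using g below by auto
  next
    fix n assume n: "0 \<le> n \<and> {0..n - 1} \<subseteq> A + A \<and> n \<notin> A + A"
    \<comment> \<open>An interval starting at 0 inside \<open>A + A\<close> cannot contain the
      missing value g \<ge> 0, so it ends before g.\<close>
    then have "g \<notin> {0..n - 1}" using g by blast
    with g have "n \<le> g" by auto
    moreover have "\<not> n < g" using n below by blast
    ultimately show "n = g" by simp
  qed
  finally have gap: "sumset_gap A = g" .
  show ?thesis
  proof
    assume "m \<le> sumset_gap A"
    then show "{0..m - 1} \<subseteq> A + A" using gap below by auto
  next
    assume "{0..m - 1} \<subseteq> A + A"
    then have "g \<notin> {0..m - 1}" using g by blast
    then show "m \<le> sumset_gap A" using gap g by auto
  qed
qed

theorem lemma1:
  fixes S :: "int set"
  assumes "numerical_semigroup S"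
  shows "(far_flung_gorenstein S \<longleftrightarrow>
            {0..sg_mult S - 1} \<subseteq>
              {(frobenius_number S - f) + (frobenius_number S - g) | f g. f \<in> rPF S \<and> g \<in> rPF S})
       \<and> ({0..sg_mult S - 1} \<subseteq>
              {(frobenius_number S - f) + (frobenius_number S - g) | f g. f \<in> rPF S \<and> g \<in> rPF S}
          \<longleftrightarrow> sg_mult S \<le> sumset_gap {frobenius_number S - f | f. f \<in> rPF S})"
proof -
  let ?K = "canonical_ideal S" and ?m = "sg_mult S"
  define B where "B = {frobenius_number S - f | f. f \<in> rPF S}"
  have B: "B = ?K \<inter> {0..?m - 1}"
    unfolding B_def by (rule rPF_reflect)
  have sums: "{(frobenius_number S - f) + (frobenius_number S - g) | f g. f \<in> rPF S \<and> g \<in> rPF S}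
      = B + B"
    unfolding B_def set_plus_def by blast
  have m: "?m \<in> S" "0 < ?m"
    using sg_mult_props[OF assms] .
  have "{0..} \<subseteq> ?K + ?K \<longleftrightarrow> {0..?m - 1} \<subseteq> B + B"
  proof
    assume K: "{0..} \<subseteq> ?K + ?K"
    show "{0..?m - 1} \<subseteq> B + B"
    proof
      fix x assume x: "x \<in> {0..?m - 1}"
      with K obtain a b where "x = a + b" "a \<in> ?K" "b \<in> ?K"
        by (auto elim!: set_plus_elim dest!: subsetD)
      moreover from this have "0 \<le> a" "0 \<le> b"
        using canonical_ideal_nonneg[OF assms] by auto
      \<comment> \<open>Nonnegative summands of x are at most x, hence below m, so both lie in
        B.\<close>
      ultimately show "x \<in> B + B"
        using x unfolding B by (auto intro!: set_plus_intro)
    qed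
  next
    assume "{0..?m - 1} \<subseteq> B + B"
    also have "B + B \<subseteq> ?K + ?K"
      unfolding B by (intro set_plus_mono2) auto
    finally show "{0..} \<subseteq> ?K + ?K"
    proof (rule nonneg_subset_of_add_closed[OF m(2)])
      fix x assume "x \<in> ?K + ?K"
      then show "x + ?m \<in> ?K + ?K"
        \<comment> \<open>The second summand absorbs m, because m \<in> S and K + S \<subseteq>
          K.\<close>
        using canonical_ideal_add[OF assms _ m(1)]
        by (metis add.assoc set_plus_elim set_plus_intro)
    qed
  qed
  moreover have "finite B" and "0 \<in> B"
    using zero_in_canonical_ideal[OF assms] m(2) by (auto simp: B)
  ultimately show ?thesis
    unfolding sums B_def[symmetric]
    using far_flung_gorenstein_iff[OF assms] le_sumset_gap_iff by simp
qed

end
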